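(* Let $\mathcal{G}$ be an ample Hausdorff groupoid, let $K$ be a field, and let $I=A_K(\mathcal{G})a$ be a minimal left ideal of $A_K(\mathcal{G})$, where $a\in A_K(\mathcal{G})$ has the form $$a=a_01_C+\sum_{i=1}^n a_i1_{B_i}$$ with $n\geq 0$, $a_0,\dots,a_n\in K$, $a_0\neq 0$, $C\subset\mathcal{G}^{(0)}$ a nonempty compact open set, $B_1,\dots,B_n\subset\mathcal{G}\setminus\mathcal{G}^{(0)}$ compact open bisections, $B_i\cap B_j=\emptyset$ for all $i\neq j$, and $r(B_i)\subseteq C$ for all $i$. Then there is an element $u\in\mathcal{G}^{(0)}$ such that $\{u\}$ is open and $u\in\mathrm{Supp}(a)$.
   Context: For a groupoid $\mathcal{G}$, $r(\gamma)=\gamma\gamma^{-1}$, $s(\gamma)=\gamma^{-1}\gamma$, and $\mathcal{G}^{(0)}$ is the unit space. An open bisection of a topological groupoid is an open set $B\subset\mathcal{G}$ such that $r|_B$ and $s|_B$ are homeomorphisms onto open subsets of $\mathcal{G}^{(0)}$. A topological groupoid is ample if its topology has a basis of compact open bisections (it is then étale, and $\mathcal{G}^{(0)}$ is open in $\mathcal{G}$). For an ample Hausdorff groupoid $\mathcal{G}$ and a field $K$, the Steinberg algebra $A_K(\mathcal{G})$ is the $K$-algebra of all locally constant functions $f:\mathcal{G}\to K$ with compact support $\mathrm{Supp}(f)=\{\gamma: f(\gamma)\neq 0\}$, with pointwise linear structure and convolution $(fg)(\gamma)=\sum_{\alpha\beta=\gamma}f(\alpha)g(\beta)$; $1_B$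 denotes the characteristic function of $B$. A minimal left ideal is a nonzero left ideal containing no left ideals other than $0$ and itself. *)

theory Defs
  imports "HOL-Analysis.Analysis"
begin

text \<open>
  The set of arrows of a groupoid is the carrier \<open>topspace (gtop G)\<close> of its topology;
  \<open>composable G\<close> is the set of pairs whose product is defined. The product and the inverse
  are total functions whose values outside these domains are irrelevant.
\<close>

record 'g top_groupoid =
  gtop :: "'g topology"
  composable :: "('g \<times> 'g) set"
  gmult :: "'g \<Rightarrow> 'g \<Rightarrow> 'g"
  ginv :: "'g \<Rightarrow> 'g"

abbreviation arrows :: "('g, 'm) top_groupoid_scheme \<Rightarrow> 'g set" where
  "arrows G \<equiv> topspace (gtop G)"

text \<open>
  The axioms of Hahn and Renault. They imply that \<open>(\<alpha>, \<beta>)\<close> is composable if and only if the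
  source of \<open>\<alpha>\<close> is the range of \<open>\<beta>\<close>.
\<close>

definition groupoid :: "('g, 'm) top_groupoid_scheme \<Rightarrow> bool" where
  "groupoid G \<longleftrightarrow>
     composable G \<subseteq> arrows G \<times> arrows G \<and>
     (\<forall>(\<alpha>, \<beta>) \<in> composable G. gmult G \<alpha> \<beta> \<in> arrows G) \<and>
     (\<forall>\<gamma> \<in> arrows G. ginv G \<gamma> \<in> arrows G \<and> ginv G (ginv G \<gamma>) = \<gamma>) \<and>
     (\<forall>\<alpha> \<beta> \<gamma>. (\<alpha>, \<beta>) \<in> composable G \<and> (\<beta>, \<gamma>) \<in> composable G \<longrightarrow>
        (gmult G \<alpha> \<beta>, \<gamma>) \<in> composable G \<and> (\<alpha>, gmult G \<beta> \<gamma>) \<in> composable G \<and>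
        gmult G (gmult G \<alpha> \<beta>) \<gamma> = gmult G \<alpha> (gmult G \<beta> \<gamma>)) \<and>
     (\<forall>\<gamma> \<in> arrows G. (ginv G \<gamma>, \<gamma>) \<in> composable G \<and> (\<gamma>, ginv G \<gamma>) \<in> composable G) \<and>
     (\<forall>(\<alpha>, \<beta>) \<in> composable G.
        gmult G (ginv G \<alpha>) (gmult G \<alpha> \<beta>) = \<beta> \<and> gmult G (gmult G \<alpha> \<beta>) (ginv G \<beta>) = \<alpha>)"

definition grange :: "('g, 'm) top_groupoid_scheme \<Rightarrow> 'g \<Rightarrow> 'g" where
  "grange G \<gamma> = gmult G \<gamma> (ginv G \<gamma>)"

definition gsource :: "('g, 'm) top_groupoid_scheme \<Rightarrow> 'g \<Rightarrow> 'g" where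
  "gsource G \<gamma> = gmult G (ginv G \<gamma>) \<gamma>"

definition unit_space :: "('g, 'm) top_groupoid_scheme \<Rightarrow> 'g set" where
  "unit_space G = grange G ` arrows G"

definition topological_groupoid :: "('g, 'm) top_groupoid_scheme \<Rightarrow> bool" where
  "topological_groupoid G \<longleftrightarrow>
     groupoid G \<and>
     continuous_map (subtopology (prod_topology (gtop G) (gtop G)) (composable G)) (gtop G)
       (\<lambda>(\<alpha>, \<beta>). gmult G \<alpha> \<beta>) \<and>
     continuous_map (gtop G) (gtop G) (ginv G)"

definition open_bisection :: "('g, 'm) top_groupoid_scheme \<Rightarrow> 'g set \<Rightarrow> bool" where
  "open_bisection G B \<longleftrightarrow>
     openin (gtop G) B \<and>
     (\<forall>\<phi> \<in> {grange G, gsource G}.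
        openin (subtopology (gtop G) (unit_space G)) (\<phi> ` B) \<and>
        homeomorphic_map (subtopology (gtop G) B) (subtopology (gtop G) (\<phi> ` B)) \<phi>)"

definition ample_groupoid :: "('g, 'm) top_groupoid_scheme \<Rightarrow> bool" where
  "ample_groupoid G \<longleftrightarrow>
     topological_groupoid G \<and>
     (\<forall>U \<gamma>. openin (gtop G) U \<and> \<gamma> \<in> U \<longrightarrow>
        (\<exists>B. compactin (gtop G) B \<and> open_bisection G B \<and> \<gamma> \<in> B \<and> B \<subseteq> U))"

text \<open>
  A function on the groupoid is represented by a function on the whole type that vanishes outside
  \<open>arrows G\<close>; for elements of the Steinberg algebra this is enforced by compactness of the support
  (\<open>compactin\<close> includes being a subset of the carrier).
\<close>

definition Supp :: "('g \<Rightarrow> 'k::zero) \<Rightarrow> 'g set" where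
  "Supp f = {\<gamma>. f \<gamma> \<noteq> 0}"

definition steinberg_algebra :: "('g, 'm) top_groupoid_scheme \<Rightarrow> ('g \<Rightarrow> 'k::field) set" where
  "steinberg_algebra G =
     {f. (\<forall>\<gamma> \<in> arrows G. \<exists>U. openin (gtop G) U \<and> \<gamma> \<in> U \<and> (\<forall>\<eta> \<in> U. f \<eta> = f \<gamma>)) \<and>
         compactin (gtop G) (Supp f)}"

text \<open>
  The sum ranges over the nonzero terms only: a sum over an infinite set is \<open>0\<close> by convention in
  HOL, while for \<open>f\<close> and \<open>g\<close> in the Steinberg algebra only finitely many terms are nonzero.
\<close>

definition conv ::
  "('g, 'm) top_groupoid_scheme \<Rightarrow> ('g \<Rightarrow> 'k::field) \<Rightarrow> ('g \<Rightarrow> 'k) \<Rightarrow> 'g \<Rightarrow> 'k" where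
  "conv G f g \<gamma> =
     (\<Sum>(\<alpha>, \<beta>) \<in> {(\<alpha>, \<beta>) \<in> composable G. gmult G \<alpha> \<beta> = \<gamma> \<and> f \<alpha> * g \<beta> \<noteq> 0}. f \<alpha> * g \<beta>)"

text \<open>
  Left ideals in the ring-theoretic sense. They are automatically closed under scalars, since the
  Steinberg algebra of an ample Hausdorff groupoid has local units.
\<close>

definition left_ideal ::
  "('g, 'm) top_groupoid_scheme \<Rightarrow> ('g \<Rightarrow> 'k::field) set \<Rightarrow> bool" where
  "left_ideal G I \<longleftrightarrow>
     I \<subseteq> steinberg_algebra G \<and>
     (\<lambda>\<gamma>. 0) \<in> I \<and>
     (\<forall>f \<in> I. \<forall>g \<in> I. (\<lambda>\<gamma>. f \<gamma> + g \<gamma>) \<in> I) \<and>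
     (\<forall>f \<in> I. (\<lambda>\<gamma>. - f \<gamma>) \<in> I) \<and>
     (\<forall>f \<in> steinberg_algebra G. \<forall>g \<in> I. conv G f g \<in> I)"

definition minimal_left_ideal ::
  "('g, 'm) top_groupoid_scheme \<Rightarrow> ('g \<Rightarrow> 'k::field) set \<Rightarrow> bool" where
  "minimal_left_ideal G I \<longleftrightarrow>
     left_ideal G I \<and> I \<noteq> {\<lambda>\<gamma>. 0} \<and>
     (\<forall>J. left_ideal G J \<and> J \<subseteq> I \<longrightarrow> J = {\<lambda>\<gamma>. 0} \<or> J = I)"

end

theory Submission
  imports Defs
begin

text \<open>
  Fix a unit \<open>x \<in> C\<close> and let \<open>G\<^sub>x\<close> be its source fibre, the set of arrows with source \<open>x\<close>.
  In a product \<open>\<gamma> = \<alpha>\<beta>\<close> the factor \<open>\<beta>\<close> has the source of \<open>\<gamma>\<close>, so \<open>(fg)|G\<^sub>x\<close> depends only on \<open>f\<close>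
  and \<open>g|G\<^sub>x\<close>, and the elements of \<open>I\<close> that vanish on \<open>G\<^sub>x\<close> form a left ideal
  (\<open>left_ideal_vanishing_on_source_fibre\<close>). The arrows of \<open>Supp a\<close> have range in \<open>C\<close>, so
  \<open>a = 1\<^sub>C a\<close> lies in \<open>I\<close>; and \<open>a x = c 0 \<noteq> 0\<close>, since the \<open>B\<^sub>i\<close> contain no units. Minimality
  therefore forces this left ideal to be zero: a nonzero element of \<open>I\<close> cannot vanish on \<open>G\<^sub>x\<close>.

  On the other hand \<open>Supp a\<close> meets \<open>G\<^sub>x\<close> in a finite set, because the source map is injective on
  each \<open>B\<^sub>i\<close> and on \<open>C\<close>. Let \<open>F\<close> be the finite set of ranges of these arrows. If \<open>C\<close> had a point
  outside \<open>F\<close>, then some nonempty compact open \<open>V \<subseteq> C\<close> would avoid \<open>F\<close>. The product \<open>1\<^sub>V a\<close> is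
  the restriction of \<open>a\<close> to the arrows with range in \<open>V\<close> (\<open>conv_indicator_units\<close>); it would vanish
  on \<open>G\<^sub>x\<close> but take the value \<open>c 0 \<noteq> 0\<close> on \<open>V\<close>, a contradiction. Hence \<open>C \<subseteq> F\<close> is finite, and
  every point of a finite open set in a Hausdorff space is isolated.
\<close>

section \<open>Ranges, sources and units\<close>

lemma groupoidD:
  assumes "groupoid G"
  shows composable_arrows: "(\<alpha>, \<beta>) \<in> composable G \<Longrightarrow> \<alpha> \<in> arrows G \<and> \<beta> \<in> arrows G"
    and gmult_arrows: "(\<alpha>, \<beta>) \<in> composable G \<Longrightarrow> gmult G \<alpha> \<beta> \<in> arrows G"
    and ginv_ginv: "\<gamma> \<in> arrows G \<Longrightarrow> ginv G (ginv G \<gamma>) = \<gamma>"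
    and composable_left: "(\<alpha>, \<beta>) \<in> composable G \<Longrightarrow> (\<beta>, \<gamma>) \<in> composable G \<Longrightarrow>
      (gmult G \<alpha> \<beta>, \<gamma>) \<in> composable G"
    and composable_right: "(\<alpha>, \<beta>) \<in> composable G \<Longrightarrow> (\<beta>, \<gamma>) \<in> composable G \<Longrightarrow>
      (\<alpha>, gmult G \<beta> \<gamma>) \<in> composable G"
    and gmult_assoc: "(\<alpha>, \<beta>) \<in> composable G \<Longrightarrow> (\<beta>, \<gamma>) \<in> composable G \<Longrightarrow>
      gmult G (gmult G \<alpha> \<beta>) \<gamma> = gmult G \<alpha> (gmult G \<beta> \<gamma>)"
    and ginv_composable_left: "\<gamma> \<in> arrows G \<Longrightarrow> (ginv G \<gamma>, \<gamma>) \<in> composable G"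
    and ginv_composable_right: "\<gamma> \<in> arrows G \<Longrightarrow> (\<gamma>, ginv G \<gamma>) \<in> composable G"
    and cancel_left: "(\<alpha>, \<beta>) \<in> composable G \<Longrightarrow> gmult G (ginv G \<alpha>) (gmult G \<alpha> \<beta>) = \<beta>"
  using assms unfolding groupoid_def by (simp_all add: split_beta Ball_def subset_eq)

lemma cancel_right:
  assumes "groupoid G" and "(\<alpha>, \<beta>) \<in> composable G"
  shows "gmult G (gmult G \<alpha> \<beta>) (ginv G \<beta>) = \<alpha>"
proof -
  have "\<forall>(\<alpha>, \<beta>) \<in> composable G. gmult G (ginv G \<alpha>) (gmult G \<alpha> \<beta>) = \<beta> \<and>
      gmult G (gmult G \<alpha> \<beta>) (ginv G \<beta>) = \<alpha>"
    using assms(1) unfolding groupoid_def by (elim conjE)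
  then show ?thesis using assms(2) by blast
qed

text \<open>
  Cancelling \<open>\<beta>\<close> on the right and \<open>\<alpha>\<close> on the left, the product \<open>\<alpha>\<^sup>-\<^sup>1(\<alpha>\<beta>)\<beta>\<^sup>-\<^sup>1\<close> evaluates to
  \<open>\<alpha>\<^sup>-\<^sup>1\<alpha>\<close> in one bracketing and to \<open>\<beta>\<beta>\<^sup>-\<^sup>1\<close> in the other.
\<close>

lemma gsource_eq_grange:
  assumes G: "groupoid G" and c: "(\<alpha>, \<beta>) \<in> composable G"
  shows "gsource G \<alpha> = grange G \<beta>"
proof -
  have arr: "\<alpha> \<in> arrows G" "\<beta> \<in> arrows G" using composable_arrows[OF G c] by auto
  have l: "(ginv G \<alpha>, gmult G \<alpha> \<beta>) \<in> composable G"
    by (rule composable_right[OF G ginv_composable_left[OF G arr(1)] c])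
  have r: "(gmult G \<alpha> \<beta>, ginv G \<beta>) \<in> composable G"
    by (rule composable_left[OF G c ginv_composable_right[OF G arr(2)]])
  have "gsource G \<alpha> = gmult G (ginv G \<alpha>) (gmult G (gmult G \<alpha> \<beta>) (ginv G \<beta>))"
    by (simp add: gsource_def cancel_right[OF G c])
  also have "\<dots> = gmult G (gmult G (ginv G \<alpha>) (gmult G \<alpha> \<beta>)) (ginv G \<beta>)"
    by (simp add: gmult_assoc[OF G l r])
  also have "\<dots> = grange G \<beta>"
    by (simp add: grange_def cancel_left[OF G c])
  finally show ?thesis .
qed

lemma gsource_gmult:
  assumes G: "groupoid G" and c: "(\<alpha>, \<beta>) \<in> composable G"
  shows "gsource G (gmult G \<alpha> \<beta>) = gsource G \<beta>"
proof -
  have b: "\<beta> \<in> arrows G" using composable_arrows[OF G c] by auto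
  have "(gmult G \<alpha> \<beta>, ginv G \<beta>) \<in> composable G"
    by (rule composable_left[OF G c ginv_composable_right[OF G b]])
  from gsource_eq_grange[OF G this] show ?thesis
    by (simp add: grange_def gsource_def ginv_ginv[OF G b])
qed

lemma unit_gsource_grange:
  assumes G: "groupoid G" and u: "u \<in> unit_space G"
  shows "u \<in> arrows G" and "gsource G u = u" and "grange G u = u"
proof -
  obtain \<gamma> where g: "\<gamma> \<in> arrows G" and u_eq: "u = gmult G \<gamma> (ginv G \<gamma>)"
    using u by (auto simp: unit_space_def grange_def)
  have c: "(\<gamma>, ginv G \<gamma>) \<in> composable G" by (rule ginv_composable_right[OF G g])
  have s: "gsource G (ginv G \<gamma>) = u" by (simp add: gsource_def ginv_ginv[OF G g] u_eq)
  show "u \<in> arrows G" using gmult_arrows[OF G c] u_eq by simp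
  show "gsource G u = u" using gsource_gmult[OF G c] s u_eq by simp
  have "(ginv G \<gamma>, u) \<in> composable G"
    unfolding u_eq by (rule composable_right[OF G ginv_composable_left[OF G g] c])
  from gsource_eq_grange[OF G this] show "grange G u = u" using s by simp
qed

lemma unit_gmult:
  assumes G: "groupoid G" and u: "u \<in> unit_space G" and c: "(u, \<beta>) \<in> composable G"
  shows "gmult G u \<beta> = \<beta>"
proof -
  obtain \<gamma> where g: "\<gamma> \<in> arrows G" and u_eq: "u = gmult G \<gamma> (ginv G \<gamma>)"
    using u by (auto simp: unit_space_def grange_def)
  have c1: "(ginv G \<gamma>, \<gamma>) \<in> composable G" and c2: "(\<gamma>, ginv G \<gamma>) \<in> composable G"
    by (rule ginv_composable_left[OF G g], rule ginv_composable_right[OF G g])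
  have "(ginv G \<gamma>, u) \<in> composable G"
    unfolding u_eq by (rule composable_right[OF G c1 c2])
  from composable_left[OF G this c] have c3: "(ginv G \<gamma>, \<beta>) \<in> composable G"
    by (simp add: u_eq cancel_left[OF G c2])
  show ?thesis
    using cancel_left[OF G c3] by (simp add: u_eq gmult_assoc[OF G c2 c3] ginv_ginv[OF G g])
qed

lemma grange_gmult_self:
  assumes G: "groupoid G" and g: "\<gamma> \<in> arrows G"
  shows "(grange G \<gamma>, \<gamma>) \<in> composable G" and "gmult G (grange G \<gamma>) \<gamma> = \<gamma>"
proof -
  show c: "(grange G \<gamma>, \<gamma>) \<in> composable G"
    unfolding grange_def
    by (rule composable_left[OF G ginv_composable_right[OF G g] ginv_composable_left[OF G g]])
  show "gmult G (grange G \<gamma>) \<gamma> = \<gamma>"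
    by (rule unit_gmult[OF G _ c]) (use g in \<open>simp add: unit_space_def\<close>)
qed

section \<open>Convolution and left ideals\<close>

lemma indicator_in_steinberg_algebra:
  assumes "Hausdorff_space (gtop G)" and V: "openin (gtop G) V" "compactin (gtop G) V"
  shows "(indicator V :: 'g \<Rightarrow> 'k::field) \<in> steinberg_algebra (G :: ('g, 'm) top_groupoid_scheme)"
proof -
  have "closedin (gtop G) V" using assms by (simp add: compactin_imp_closedin)
  then have out: "openin (gtop G) (arrows G - V)" by blast
  have supp: "Supp (indicator V :: 'g \<Rightarrow> 'k) = V" by (auto simp: Supp_def indicator_def)
  have "\<exists>U. openin (gtop G) U \<and> \<gamma> \<in> U \<and> (\<forall>\<eta>\<in>U. indicator V \<eta> = (indicator V \<gamma> :: 'k))"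
    if "\<gamma> \<in> arrows G" for \<gamma>
  proof (cases "\<gamma> \<in> V")
    case True
    then show ?thesis using V(1) by (intro exI[of _ V]) auto
  next
    case False
    then show ?thesis using out that by (intro exI[of _ "arrows G - V"]) auto
  qed
  then show ?thesis unfolding steinberg_algebra_def using supp V(2) by simp
qed

text \<open>
  A factorisation of \<open>\<gamma>\<close> whose left factor is a unit must be \<open>\<gamma> = r(\<gamma>) \<gamma>\<close>, so the convolution sum
  has at most one term.
\<close>

lemma conv_indicator_units:
  fixes f :: "'g \<Rightarrow> 'k::field"
  assumes G: "groupoid G" and V: "V \<subseteq> unit_space G" and f: "Supp f \<subseteq> arrows G"
  shows "conv G (indicator V) f \<gamma> = (if grange G \<gamma> \<in> V then f \<gamma> else 0)"
proof -
  define S where "S = {(\<alpha>, \<beta>) \<in> composable G.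
    gmult G \<alpha> \<beta> = \<gamma> \<and> indicator V \<alpha> * f \<beta> \<noteq> 0}"
  have eq: "\<alpha> = grange G \<gamma> \<and> \<beta> = \<gamma> \<and> grange G \<gamma> \<in> V \<and> f \<gamma> \<noteq> 0" if "(\<alpha>, \<beta>) \<in> S" for \<alpha> \<beta>
  proof -
    have c: "(\<alpha>, \<beta>) \<in> composable G" and p: "gmult G \<alpha> \<beta> = \<gamma>" and v: "\<alpha> \<in> V" and nz: "f \<beta> \<noteq> 0"
      using that by (auto simp: S_def indicator_def split: if_splits)
    have b: "\<beta> = \<gamma>" using unit_gmult[OF G _ c] v V p by auto
    have "\<alpha> = grange G \<gamma>" using cancel_right[OF G c] p b by (simp add: grange_def)
    then show ?thesis using v nz b by simp
  qed
  have S_eq: "S = (if grange G \<gamma> \<in> V \<and> f \<gamma> \<noteq> 0 then {(grange G \<gamma>, \<gamma>)} else {})"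
  proof (cases "grange G \<gamma> \<in> V \<and> f \<gamma> \<noteq> 0")
    case True
    then have "\<gamma> \<in> arrows G" using f by (auto simp: Supp_def)
    with True have "(grange G \<gamma>, \<gamma>) \<in> S"
      using grange_gmult_self[OF G] by (simp add: S_def)
    moreover have "S \<subseteq> {(grange G \<gamma>, \<gamma>)}" by (rule subrelI) (drule eq, simp)
    ultimately show ?thesis using True by (simp add: subset_singleton_iff) blast
  next
    case False
    have "p \<notin> S" for p using eq[of "fst p" "snd p"] False by auto
    then have "S = {}" by blast
    with False show ?thesis by simp
  qed
  have "conv G (indicator V) f \<gamma> = (\<Sum>(\<alpha>, \<beta>) \<in> S. indicator V \<alpha> * f \<beta>)"
    by (simp add: conv_def S_def)
  then show ?thesis by (simp add: S_eq)
qed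

text \<open>
  If \<open>\<alpha>\<beta>\<close> has source \<open>x\<close>, then so does \<open>\<beta>\<close>; thus all terms of the convolution sum for \<open>fg\<close> at an
  arrow with source \<open>x\<close> involve values of \<open>g\<close> on the same source fibre.
\<close>

lemma left_ideal_vanishing_on_source_fibre:
  fixes I :: "('g \<Rightarrow> 'k::field) set"
  assumes G: "groupoid G" and I: "left_ideal G I"
  shows "left_ideal G {g \<in> I. \<forall>\<gamma>. gsource G \<gamma> = x \<longrightarrow> g \<gamma> = 0}"
proof -
  have "conv G f g \<gamma> = 0"
    if van: "\<forall>\<gamma>. gsource G \<gamma> = x \<longrightarrow> g \<gamma> = 0" and x: "gsource G \<gamma> = x"
    for f g :: "'g \<Rightarrow> 'k" and \<gamma>
  proof -
    have "{(\<alpha>, \<beta>) \<in> composable G. gmult G \<alpha> \<beta> = \<gamma> \<and> f \<alpha> * g \<beta> \<noteq> 0} = {}"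
      using van x gsource_gmult[OF G] by fastforce
    then show ?thesis unfolding conv_def by (simp only: sum.empty)
  qed
  then show ?thesis using I unfolding left_ideal_def by auto
qed

text \<open>
  The left ideal just found is proper as soon as some element of \<open>I\<close> is nonzero somewhere on the
  source fibre of \<open>x\<close>.
\<close>

lemma minimal_left_ideal_vanishing_on_source_fibre:
  assumes G: "groupoid G" and I: "minimal_left_ideal G I"
    and a: "a \<in> I" "gsource G \<eta> = x" "a \<eta> \<noteq> 0"
    and g: "g \<in> I" "\<And>\<gamma>. gsource G \<gamma> = x \<Longrightarrow> g \<gamma> = 0"
  shows "g = (\<lambda>\<gamma>. 0)"
proof -
  let ?J = "{g \<in> I. \<forall>\<gamma>. gsource G \<gamma> = x \<longrightarrow> g \<gamma> = 0}"
  have "left_ideal G ?J"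
    by (rule left_ideal_vanishing_on_source_fibre[OF G]) (use I in \<open>simp add: minimal_left_ideal_def\<close>)
  moreover have "?J \<noteq> I" using a by blast
  ultimately have "?J = {\<lambda>\<gamma>. 0}" using I unfolding minimal_left_ideal_def by auto
  then show ?thesis using g by blast
qed

section \<open>Isolated units\<close>

lemma openin_singleton_of_finite_openin:
  assumes "Hausdorff_space X" and "openin X C" and "finite C" and "x \<in> C"
  shows "openin X {x}"
proof -
  have "closedin X (C - {x})"
    using assms openin_subset by (intro closedin_Hausdorff_finite) auto
  then have "openin X (C - (C - {x}))" using assms(2) by (rule openin_diff[rotated])
  moreover have "C - (C - {x}) = {x}" using assms(4) by auto
  ultimately show ?thesis by simp
qed

theorem proposition3p8:
  fixes G :: "'g top_groupoid"
    and I :: "('g \<Rightarrow> 'k::field) set"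
    and a :: "'g \<Rightarrow> 'k"
    and n :: nat
    and c :: "nat \<Rightarrow> 'k"
    and C :: "'g set"
    and B :: "nat \<Rightarrow> 'g set"
  assumes "ample_groupoid G"
    and "Hausdorff_space (gtop G)"
    and "a \<in> steinberg_algebra G"
    and "I = {conv G f a | f. f \<in> steinberg_algebra G}"
    and "minimal_left_ideal G I"
    and "a = (\<lambda>\<gamma>. c 0 * indicator C \<gamma> + (\<Sum>i = 1..n. c i * indicator (B i) \<gamma>))"
    and "c 0 \<noteq> 0"
    and "C \<subseteq> unit_space G" and "C \<noteq> {}" and "compactin (gtop G) C" and "openin (gtop G) C"
    and "\<And>i. i \<in> {1..n} \<Longrightarrow> B i \<subseteq> arrows G - unit_space G"
    and "\<And>i. i \<in> {1..n} \<Longrightarrow> compactin (gtop G) (B i) \<and> open_bisection G (B i)"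
    and "\<And>i j. i \<in> {1..n} \<Longrightarrow> j \<in> {1..n} \<Longrightarrow> i \<noteq> j \<Longrightarrow> B i \<inter> B j = {}"
    and "\<And>i. i \<in> {1..n} \<Longrightarrow> grange G ` B i \<subseteq> C"
  shows "\<exists>u \<in> unit_space G. openin (gtop G) {u} \<and> u \<in> Supp a"
proof -
  have G: "groupoid G"
    using assms(1) by (simp add: ample_groupoid_def topological_groupoid_def)
  have supp_a: "Supp a \<subseteq> arrows G"
    using assms(3) by (auto simp: steinberg_algebra_def dest: compactin_subset_topspace)
  obtain x where x: "x \<in> C" using assms(9) by auto
  have a_C: "a u = c 0" if "u \<in> C" for u
  proof -
    have "(\<Sum>i = 1..n. c i * indicator (B i) u) = 0"
      using that assms(8) assms(12)[THEN subsetD] by (intro sum.neutral) (fastforce simp: indicator_def)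
    then show ?thesis using that by (simp add: assms(6))
  qed
  have supp_cases: "\<gamma> \<in> C \<or> (\<exists>i\<in>{1..n}. \<gamma> \<in> B i)" if "a \<gamma> \<noteq> 0" for \<gamma>
  proof (rule ccontr)
    assume "\<not> ?thesis"
    then have "\<gamma> \<notin> C" and "(\<Sum>i = 1..n. c i * indicator (B i) \<gamma>) = 0"
      by (auto intro!: sum.neutral)
    then have "a \<gamma> = 0" by (simp add: assms(6))
    with that show False by simp
  qed
  have "grange G \<gamma> \<in> C" if "a \<gamma> \<noteq> 0" for \<gamma>
    using supp_cases[OF that] assms(8,15) unit_gsource_grange(3)[OF G] by fastforce
  then have "conv G (indicator C) a = a"
    by (auto simp: fun_eq_iff conv_indicator_units[OF G assms(8) supp_a])
  then have a_I: "a \<in> I"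
    unfolding assms(4)
    using indicator_in_steinberg_algebra[OF assms(2,11,10), where 'k = 'k] by force
  define E where "E = {\<gamma> \<in> Supp a. gsource G \<gamma> = x}"
  have "E \<subseteq> {x} \<union> (\<Union>i\<in>{1..n}. {\<gamma> \<in> B i. gsource G \<gamma> = x})"
    using supp_cases assms(8) unit_gsource_grange(2)[OF G] by (fastforce simp: E_def Supp_def)
  moreover have "finite {\<gamma> \<in> B i. gsource G \<gamma> = x}" if i: "i \<in> {1..n}" for i
  proof -
    have bis: "open_bisection G (B i)" using assms(13)[OF i] by simp
    then have "homeomorphic_map (subtopology (gtop G) (B i))
        (subtopology (gtop G) (gsource G ` B i)) (gsource G)"
      by (simp add: open_bisection_def)
    then have "inj_on (gsource G) (arrows G \<inter> B i)"
      using homeomorphic_imp_injective_map by fastforce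
    moreover have "B i \<subseteq> arrows G"
      using bis by (auto simp: open_bisection_def dest: openin_subset)
    ultimately have "inj_on (gsource G) (B i)" by (simp add: Int_absorb1)
    then have "finite (gsource G -` {x} \<inter> B i)" by (intro finite_vimage_IntI) auto
    then show ?thesis by (rule rev_finite_subset) auto
  qed
  ultimately have "finite E" by (auto intro: finite_subset)
  have "C \<subseteq> grange G ` E"
  proof
    fix v assume v: "v \<in> C"
    show "v \<in> grange G ` E"
    proof (rule ccontr)
      assume out: "v \<notin> grange G ` E"
      have "closedin (gtop G) (grange G ` E \<inter> C)"
        using \<open>finite E\<close> assms(2,11) openin_subset by (intro closedin_Hausdorff_finite) auto
      then have "openin (gtop G) (C - grange G ` E \<inter> C)" using assms(11) by auto
      then obtain V where V: "compactin (gtop G) V" "open_bisection G V" "v \<in> V"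
          and V_sub: "V \<subseteq> C - grange G ` E \<inter> C"
        using assms(1) v out unfolding ample_groupoid_def by blast
      have V_units: "V \<subseteq> unit_space G" using V_sub assms(8) by auto
      let ?g = "conv G (indicator V) a"
      have g: "?g \<gamma> = (if grange G \<gamma> \<in> V then a \<gamma> else 0)" for \<gamma>
        by (rule conv_indicator_units[OF G V_units supp_a])
      \<comment> \<open>No arrow of \<open>Supp a\<close> with source \<open>x\<close> has its range in \<open>V\<close>, so \<open>?g\<close> vanishes over \<open>x\<close>.\<close>
      have "?g = (\<lambda>\<gamma>. 0)"
      proof (rule minimal_left_ideal_vanishing_on_source_fibre[OF G assms(5) a_I])
        show "gsource G x = x" using unit_gsource_grange(2)[OF G] x assms(8) by auto
        show "a x \<noteq> 0" using a_C[OF x] assms(7) by simp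
        have "openin (gtop G) V" using V(2) by (simp add: open_bisection_def)
        then show "?g \<in> I"
          unfolding assms(4)
          using indicator_in_steinberg_algebra[OF assms(2) _ V(1), where 'k = 'k] by blast
        show "?g \<gamma> = 0" if "gsource G \<gamma> = x" for \<gamma>
          using that V_sub by (auto simp: g E_def Supp_def)
      qed
      then have "?g v = 0" by (rule fun_cong)
      moreover have "?g v = c 0"
        using g V(3) V_units unit_gsource_grange(3)[OF G] a_C[OF v] by auto
      ultimately show False using assms(7) by simp
    qed
  qed
  then have "finite C" using \<open>finite E\<close> by (rule finite_surj[rotated])
  then have "openin (gtop G) {x}"
    using assms(2,11) x by (intro openin_singleton_of_finite_openin)
  moreover have "x \<in> Supp a" using a_C[OF x] assms(7) by (simp add: Supp_def)
  ultimately show ?thesis using x assms(8) by auto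
qed

end
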